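(* Let $n\ge1$ and $\mu\in\mathbb{T}^{2^{[n]}}$ be such that $\supp(\mu)=\{A\subseteq[n]:\mu(A)<\infty\}$ is a strong Coxeter matroid of type $B_n$. Then the following are equivalent: (a) $\mu\in\mathrm{Dr}(B_n,P_n)$; (b) $\mu$ satisfies the four term strong exchange equations, i.e. $\mu\in V^{\mathrm{trop}}(f^B_{I,J})$ for all $I,J\subseteq[n]$ with $3\le|I\triangle J|\le4$. Moreover, if all entries of $\mu$ are finite, then in (b) it suffices to consider only $I,J$ with $|I\triangle J|=3$.
   Context: $\mathbb{T}=\mathbb{R}\cup\{\infty\}$ with $\oplus=\min$, $\odot=+$; $\nu\in V^{\mathrm{trop}}(f)$ means the minimum of the monomials of $f$ at $\nu$ is $\infty$ or attained at least twice. For $I,J\subseteq[n]$, with $I\triangle i=I\triangle\{i\}$: $f^B_{I,J}=\bigoplus_{i\in I\triangle J}x_{I\triangle i}\odot x_{J\triangle i}$ if $|I\triangle J|$ is even and $x_I\odot x_J\oplus\bigoplus_{i\in I\triangle J}x_{I\triangle i}\odot x_{J\triangle i}$ if odd. $\mathrm{Dr}(B_n,P_n)=\bigcap_{|I\triangle J|\ge3}V^{\mathrm{trop}}(f^B_{I,J})$. Subsets $A\subseteq[n]$ are identified with vertices $e_A-(\tfrac12,\dots,\tfrac12)$ of a cube in $\mathbb{R}^n$; the type $B_n$ roots are $\pm e_i$, $\pm e_i\pm e_j$ ($i\neq j$), acting by reflections. $\mathcal{M}\subseteq2^{[n]}$ is a strong Coxeter matroid of type $B_n$ if for all $A,B\in\mathcal{M}$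 there is a reflection $s$ in a $B_n$ root whose mirror separates $A$ and $B$ and with $sA,sB\in\mathcal{M}$. *)

theory Defs
  imports "HOL-Analysis.Analysis" "HOL-Library.Multiset"
begin

text \<open>
  The ground set $[n]$ is a finite type \<open>'n\<close> with \<open>CARD('n) = n\<close>, so that $2^{[n]}$ is the type
  \<open>'n set\<close> and $\mathbb{R}^n$ is \<open>real ^ 'n\<close>. The tropical semiring is the set of extended
  reals other than \<open>-\<infinity>\<close>, with \<open>inf\<close> (that is, \<open>min\<close>) as addition and \<open>+\<close> as multiplication.
\<close>

definition trop :: "ereal set" where
  "trop = {t. t \<noteq> - \<infinity>}"

definition trop_space :: "('v \<Rightarrow> ereal) set" where
  "trop_space = {\<nu>. \<forall>v. \<nu> v \<in> trop}"

text \<open>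
  A tropical polynomial is its coefficient function. A monomial is a multiset of variables;
  a coefficient \<open>\<infinity>\<close> means that the monomial does not occur. Tropical addition of polynomials is
  the pointwise infimum, and the tropical unit coefficient is \<open>0\<close>.
\<close>

type_synonym 'v trop_poly = "'v multiset \<Rightarrow> ereal"

definition trop_monom :: "'v multiset \<Rightarrow> 'v trop_poly" where
  "trop_monom m = (\<lambda>u. if u = m then 0 else \<infinity>)"

definition monom_value :: "'v trop_poly \<Rightarrow> ('v \<Rightarrow> ereal) \<Rightarrow> 'v multiset \<Rightarrow> ereal" where
  "monom_value f \<nu> u = f u + (\<Sum>v\<in>#u. \<nu> v)"

definition trop_eval :: "'v trop_poly \<Rightarrow> ('v \<Rightarrow> ereal) \<Rightarrow> ereal" where
  "trop_eval f \<nu> = (INF u. monom_value f \<nu> u)"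

definition V_trop :: "'v trop_poly \<Rightarrow> ('v \<Rightarrow> ereal) set" where
  "V_trop f = {\<nu> \<in> trop_space. trop_eval f \<nu> = \<infinity> \<or>
     (\<exists>u w. u \<noteq> w \<and> monom_value f \<nu> u = trop_eval f \<nu> \<and> monom_value f \<nu> w = trop_eval f \<nu>)}"

definition fB :: "'n::finite set \<Rightarrow> 'n set \<Rightarrow> 'n set trop_poly" where
  "fB I J =
     (let s = (INF i\<in>sym_diff I J. trop_monom {#sym_diff I {i}, sym_diff J {i}#})
      in if even (card (sym_diff I J)) then s else inf (trop_monom {#I, J#}) s)"

definition DrB :: "('n::finite set \<Rightarrow> ereal) set" where
  "DrB = trop_space \<inter> (\<Inter>(I, J) \<in> {(I, J). 3 \<le> card (sym_diff I J)}. V_trop (fB I J))"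

definition trop_supp :: "('v \<Rightarrow> ereal) \<Rightarrow> 'v set" where
  "trop_supp \<mu> = {A. \<mu> A < \<infinity>}"

definition cube_vertex :: "'n::finite set \<Rightarrow> real ^ 'n" where
  "cube_vertex A = (\<Sum>i\<in>A. axis i 1) - (\<chi> i. 1/2)"

definition B_roots :: "(real ^ 'n::finite) set" where
  "B_roots = {c *\<^sub>R axis i 1 | c i. c \<in> {1, -1}}
     \<union> {c *\<^sub>R axis i 1 + d *\<^sub>R axis j 1 | c d i j. c \<in> {1, -1} \<and> d \<in> {1, -1} \<and> i \<noteq> j}"

definition root_reflection :: "real ^ 'n::finite \<Rightarrow> real ^ 'n \<Rightarrow> real ^ 'n" where
  "root_reflection \<alpha> x = x - (2 * (\<alpha> \<bullet> x) / (\<alpha> \<bullet> \<alpha>)) *\<^sub>R \<alpha>"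

text \<open>The points lie in opposite open half-spaces bounded by the mirror $\alpha^\perp$.\<close>

definition mirror_separates :: "real ^ 'n::finite \<Rightarrow> real ^ 'n \<Rightarrow> real ^ 'n \<Rightarrow> bool" where
  "mirror_separates \<alpha> x y \<longleftrightarrow> (\<alpha> \<bullet> x < 0 \<and> 0 < \<alpha> \<bullet> y) \<or> (\<alpha> \<bullet> y < 0 \<and> 0 < \<alpha> \<bullet> x)"

text \<open>The exchange property concerns distinct members, as no mirror separates a point from itself.\<close>

definition strong_coxeter_matroid_B :: "'n::finite set set \<Rightarrow> bool" where
  "strong_coxeter_matroid_B M \<longleftrightarrow>
     (\<forall>A\<in>M. \<forall>B\<in>M. A \<noteq> B \<longrightarrow>
       (\<exists>\<alpha>\<in>B_roots. mirror_separates \<alpha> (cube_vertex A) (cube_vertex B) \<and>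
          root_reflection \<alpha> (cube_vertex A) \<in> cube_vertex ` M \<and>
          root_reflection \<alpha> (cube_vertex B) \<in> cube_vertex ` M))"

end

theory Submission
  imports Defs
begin

text \<open>
  Adding an element \<open>None\<close> to the ground set turns type $B_n$ into type $D_{n+1}$: pairs of subsets
  whose symmetric difference has odd size acquire one with symmetric difference of even size, the
  exceptional monomial $x_I x_J$ becomes the one indexed by \<open>None\<close>, and the tropical equations
  become the strong exchange property of a valuated even delta-matroid. The latter is passed from
  symmetric differences of size 4 to larger ones by induction, in the manner of Murota: if exchange
  fails for $(A, B)$ at $i$, a linear potential makes $A$ minimal among all $A \triangle \{i, j\}$
  and $B$ strictly minimal among all $B \triangle \{i, j\}$; for the cheapest pair $\{u, v\}$ avoiding
  $i$, the four term relation shows that exchange fails for $(A, B \triangle \{u, v\})$ at $i$ as well.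
  The strong Coxeter property is only needed for the existence of such a pair.
\<close>

section \<open>Exchange property: from symmetric differences of size 4 to all even sizes\<close>

text \<open>This is the condition that a tropical equation puts on one of its monomials, namely the
  one given by the pair \<open>A\<close>, \<open>B\<close>: some other monomial, indexed by
  \<open>j\<close>, is no larger. It holds at every \<open>i\<close> exactly when the minimum is
  infinite or attained twice.\<close>

definition exchange :: "('a set \<Rightarrow> ereal) \<Rightarrow> 'a set \<Rightarrow> 'a set \<Rightarrow> 'a \<Rightarrow> bool" where
  "exchange \<omega> A B i \<longleftrightarrow> (\<exists>j\<in>sym_diff A B - {i}.
     \<omega> (sym_diff A {i, j}) + \<omega> (sym_diff B {i, j}) \<le> \<omega> A + \<omega> B)"

lemma exchange_commute: "exchange \<omega> A B i \<longleftrightarrow> exchange \<omega> B A i"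
  unfolding exchange_def by (simp add: Un_commute add.commute)

text \<open>Supplies the value \<open>q\<close> of the linear potential at a single element.\<close>

lemma ereal_add_less_split:
  fixes x y :: ereal
  assumes "ereal a + ereal b < x + y" "x \<noteq> -\<infinity>" "y \<noteq> -\<infinity>"
  obtains q where "ereal a \<le> x + ereal q" "ereal (b + q) < y"
proof (cases x)
  case (real r)
  show thesis
    using assms real by (intro that[of "a - r"]) (cases y; simp)+
next
  case PInf
  show thesis
  proof (cases y)
    case (real s)
    then show thesis using PInf by (intro that[of "s - b - 1"]) auto
  next
    case PInf
    then show thesis using \<open>x = \<infinity>\<close> by (intro that[of 0]) auto
  qed (use assms in auto)
qed (use assms in auto)

text \<open>Induction step of the local-to-global argument. The pair \<open>u0\<close>,
  \<open>v0\<close> ensures that the cheapest pair avoiding \<open>i\<close> has finite cost, so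
  that its value can be subtracted.\<close>

lemma exchange_step:
  fixes \<omega> :: "'a::finite set \<Rightarrow> ereal"
  assumes fin: "\<And>X. \<omega> X \<noteq> -\<infinity>"
    and loc: "\<And>X Y t. card (sym_diff X Y) = 4 \<Longrightarrow> t \<in> sym_diff X Y \<Longrightarrow> exchange \<omega> X Y t"
    and IH: "\<And>X Y t. card (sym_diff X Y) + 2 = card (sym_diff A B) \<Longrightarrow>
      t \<in> sym_diff X Y \<Longrightarrow> exchange \<omega> X Y t"
    and i: "i \<in> sym_diff A B"
    and uv0: "u0 \<in> sym_diff A B - {i}" "v0 \<in> sym_diff A B - {i}" "u0 \<noteq> v0"
      "\<omega> (sym_diff B {u0, v0}) < \<infinity>"
  shows "exchange \<omega> A B i"
proof (rule ccontr)
  assume "\<not> ?thesis"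
  define D where "D = sym_diff A B"
  have no: "\<omega> A + \<omega> B < \<omega> (sym_diff A {i, j}) + \<omega> (sym_diff B {i, j})" if "j \<in> D - {i}" for j
    using \<open>\<not> exchange \<omega> A B i\<close> that unfolding exchange_def D_def by (simp add: not_le)
  have "\<omega> A + \<omega> B < \<infinity>"
    using no[of u0] uv0 by (auto simp: D_def)
  then obtain a b where ab: "\<omega> A = ereal a" "\<omega> B = ereal b"
    using fin[of A] fin[of B] by (cases "\<omega> A"; cases "\<omega> B") auto
  \<comment> \<open>Each \<open>j\<close> in \<open>D\<close> lies in exactly one of
    \<open>A\<close> and \<open>B\<close>, so toggling it changes a linear potential by opposite
    amounts on the two sides. The potential has weight 0 at \<open>i\<close> and \<open>q j\<close>
    at \<open>j\<close>; the strict part of the inequality \<open>no\<close> is kept on the side of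
    \<open>B\<close>.\<close>
  have "\<forall>j\<in>D - {i}. \<exists>q. ereal a \<le> \<omega> (sym_diff A {i, j}) + ereal q \<and>
      ereal (b + q) < \<omega> (sym_diff B {i, j})"
  proof
    fix j assume "j \<in> D - {i}"
    then show "\<exists>q. ereal a \<le> \<omega> (sym_diff A {i, j}) + ereal q \<and>
      ereal (b + q) < \<omega> (sym_diff B {i, j})"
      using ereal_add_less_split[OF no[unfolded ab] fin fin] by metis
  qed
  then obtain q where q: "\<And>j. j \<in> D - {i} \<Longrightarrow> ereal a \<le> \<omega> (sym_diff A {i, j}) + ereal (q j)"
      "\<And>j. j \<in> D - {i} \<Longrightarrow> ereal (b + q j) < \<omega> (sym_diff B {i, j})"
    by metis
  define P where "P = {(u, v). u \<in> D - {i} \<and> v \<in> D - {i} \<and> u \<noteq> v}"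
  define c where "c = (\<lambda>(u, v). \<omega> (sym_diff B {u, v}) + ereal (- q u - q v))"
  have "finite P" "(u0, v0) \<in> P"
    using uv0 by (auto simp: P_def D_def)
  then obtain p where p: "p \<in> P" and pmin: "\<And>p'. p' \<in> P \<Longrightarrow> c p \<le> c p'"
    using arg_min_if_finite[of P c] by (metis empty_iff not_less)
  obtain u v where puv: "p = (u, v)" by force
  then have uv: "u \<in> D" "v \<in> D" "u \<noteq> i" "v \<noteq> i" "u \<noteq> v"
    using p by (auto simp: P_def)
  have cmin: "c (u, v) \<le> c (u', v')" if "u' \<in> D" "v' \<in> D" "u' \<noteq> i" "v' \<noteq> i" "u' \<noteq> v'" for u' v'
    using pmin[of "(u', v')"] that by (auto simp: P_def puv)
  have "c (u, v) < \<infinity>"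
    using cmin[of u0 v0] uv0 by (auto simp: c_def D_def)
  then obtain g where g: "\<omega> (sym_diff B {u, v}) = ereal g"
    using fin[of "sym_diff B {u, v}"] by (cases "\<omega> (sym_diff B {u, v})") (auto simp: c_def)
  have gmin: "ereal (g - q u - q v + q u' + q v') \<le> \<omega> (sym_diff B {u', v'})"
    if "u' \<in> D" "v' \<in> D" "u' \<noteq> i" "v' \<noteq> i" "u' \<noteq> v'" for u' v'
    using cmin[OF that] g fin[of "sym_diff B {u', v'}"]
    by (cases "\<omega> (sym_diff B {u', v'})") (auto simp: c_def)
  let ?B = "sym_diff B {u, v}"
  have AB: "sym_diff A ?B = D - {u, v}"
    using uv by (auto simp: D_def)
  have "card D = card (D - {u, v}) + 2"
    using card_Diff_subset[of "{u, v}" D] card_mono[of D "{u, v}"] uv by auto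
  then have "exchange \<omega> A ?B i"
    using i uv by (intro IH) (auto simp: AB D_def)
  then obtain w where w: "w \<in> D" "w \<noteq> u" "w \<noteq> v" "w \<noteq> i"
    and le: "\<omega> (sym_diff A {i, w}) + \<omega> (sym_diff ?B {i, w}) \<le> ereal a + ereal g"
    unfolding exchange_def AB ab g by auto
  let ?Y = "sym_diff ?B {i, w}"
  \<comment> \<open>Minimality of \<open>A\<close> under the potential cancels the term at
    \<open>sym_diff A {i, w}\<close>, leaving a bound on the side of \<open>B\<close> alone.\<close>
  have Y: "\<omega> ?Y \<le> ereal (g + q w)"
    using le q(1)[of w] w fin[of "sym_diff A {i, w}"] fin[of ?Y]
    by (cases "\<omega> (sym_diff A {i, w})"; cases "\<omega> ?Y") auto
  have BY: "sym_diff B ?Y = {u, v, w, i}"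
    using w uv by auto
  then have "exchange \<omega> B ?Y i"
    using w uv by (intro loc) auto
  then obtain j where j: "j \<in> {u, v, w}"
    and jle: "\<omega> (sym_diff B {i, j}) + \<omega> (sym_diff ?Y {i, j}) \<le> ereal b + \<omega> ?Y"
    unfolding exchange_def BY ab by auto
  have bound: "x' + y' < b + z'"
    if "ereal x' < x" "ereal y' \<le> y" "x + y \<le> ereal b + z" "z \<le> ereal z'" "z \<noteq> -\<infinity>"
    for x y z :: ereal and x' y' z'
    using that by (cases x; cases y; cases z) auto
  \<comment> \<open>\<open>{k, l}\<close> is what remains of \<open>{u, v, w}\<close> after removing
    \<open>j\<close>. The potentials therefore have the same total on both sides of
    \<open>jle\<close>, and the strict bound at \<open>sym_diff B {i, j}\<close> together with the
    minimal cost of \<open>{u, v}\<close> contradicts \<open>jle\<close>.\<close>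
  obtain k l where kl: "k \<in> D" "l \<in> D" "k \<noteq> i" "l \<noteq> i" "k \<noteq> l"
      "sym_diff ?Y {i, j} = sym_diff B {k, l}" "q j + q k + q l = q u + q v + q w"
  proof -
    have "sym_diff ?Y {i, u} = sym_diff B {v, w}" "sym_diff ?Y {i, v} = sym_diff B {u, w}"
         "sym_diff ?Y {i, w} = sym_diff B {u, v}"
      using w uv by auto
    with j w uv that show thesis
      by (elim insertE emptyE) (smt (verit))+
  qed
  have "j \<in> D - {i}" using j uv w by auto
  then have "ereal (b + q j) < \<omega> (sym_diff B {i, j})" by (rule q)
  moreover have "ereal (g - q u - q v + q k + q l) \<le> \<omega> (sym_diff ?Y {i, j})"
    unfolding kl(6) by (rule gmin[OF kl(1-5)])
  ultimately have "b + q j + (g - q u - q v + q k + q l) < b + (g + q w)"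
    using jle Y fin[of ?Y] by (rule bound)
  then show False using kl(7) by simp
qed

text \<open>Strong induction on the size of the symmetric difference. The pair provided by
  \<open>supp\<close> may contain \<open>i\<close>, which \<open>exchange_step\<close> forbids;
  exchange in a smaller instance then yields a disjoint pair on the opposite side.\<close>

lemma exchange_local_to_global:
  fixes \<omega> :: "'a::finite set \<Rightarrow> ereal"
  assumes fin: "\<And>X. \<omega> X \<noteq> -\<infinity>"
    and loc: "\<And>X Y t. card (sym_diff X Y) = 4 \<Longrightarrow> t \<in> sym_diff X Y \<Longrightarrow> exchange \<omega> X Y t"
    and supp: "\<And>X Y. even (card (sym_diff X Y)) \<Longrightarrow> 6 \<le> card (sym_diff X Y) \<Longrightarrow>
      \<omega> X < \<infinity> \<Longrightarrow> \<omega> Y < \<infinity> \<Longrightarrow> \<exists>u\<in>sym_diff X Y. \<exists>v\<in>sym_diff X Y. u \<noteq> v \<and>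
        (\<omega> (sym_diff X {u, v}) < \<infinity> \<or> \<omega> (sym_diff Y {u, v}) < \<infinity>)"
    and "even (card (sym_diff A B))" "4 \<le> card (sym_diff A B)" "i \<in> sym_diff A B"
  shows "exchange \<omega> A B i"
  using assms(4-6)
proof (induction "card (sym_diff A B)" arbitrary: A B i rule: less_induct)
  case less
  let ?D = "sym_diff A B"
  have IH: "exchange \<omega> X Y t"
    if "card (sym_diff X Y) + 2 = card ?D" "card ?D \<noteq> 4" "t \<in> sym_diff X Y" for X Y t
  proof (rule less.hyps)
    show "even (card (sym_diff X Y))" "4 \<le> card (sym_diff X Y)"
      using less.prems(1,2) that by presburger+
  qed (use that in auto)
  have step: "exchange \<omega> A B i"
    if "card ?D \<noteq> 4" "u \<in> ?D - {i}" "v \<in> ?D - {i}" "u \<noteq> v"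
      "\<omega> (sym_diff A {u, v}) < \<infinity> \<or> \<omega> (sym_diff B {u, v}) < \<infinity>" for u v
    using that(5)
  proof
    assume "\<omega> (sym_diff B {u, v}) < \<infinity>"
    then show ?thesis
      using less.prems that by (intro exchange_step[OF fin loc IH]) auto
  next
    assume "\<omega> (sym_diff A {u, v}) < \<infinity>"
    then have "exchange \<omega> B A i"
      using less.prems that
      by (intro exchange_step[of \<omega> B A i u v, OF fin loc IH]) (auto simp: Un_commute)
    then show ?thesis by (simp add: exchange_commute)
  qed
  show ?case
  proof (cases "card ?D = 4 \<or> \<omega> A = \<infinity> \<or> \<omega> B = \<infinity>")
    case True
    \<comment> \<open>If the right-hand side is infinite, every \<open>j\<close> serves, but one has
      to exist.\<close>
    have "\<not> ?D \<subseteq> {i}"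
      using less.prems(2) card_mono[of "{i}" ?D] by auto
    then obtain j where "j \<in> ?D - {i}" by blast
    with True show ?thesis
      using loc[OF _ less.prems(3)] unfolding exchange_def
      by (metis ereal_less_eq(1) plus_ereal.simps(2,3))
  next
    case False
    then have D6: "card ?D \<noteq> 4" "6 \<le> card ?D" and "\<omega> A < \<infinity>" "\<omega> B < \<infinity>"
    proof -
      have "6 \<le> n" if "even n" "4 \<le> n" "n \<noteq> 4" for n :: nat using that by presburger
      then show "card ?D \<noteq> 4" "6 \<le> card ?D" using False less.prems(1,2) by blast+
    qed (use False in auto)
    then obtain u v where uv: "u \<in> ?D" "v \<in> ?D" "u \<noteq> v"
        "\<omega> (sym_diff A {u, v}) < \<infinity> \<or> \<omega> (sym_diff B {u, v}) < \<infinity>"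
      using supp[of A B] less.prems by metis
    show ?thesis
    proof (cases "i \<in> {u, v}")
      case False
      then show ?thesis using step[of u v] uv D6 by auto
    next
      case True
      \<comment> \<open>The induction hypothesis for \<open>sym_diff X {u, v}\<close> and
        \<open>Y\<close>, both of finite value, bounds the value at \<open>sym_diff Y {k, l}\<close>
        by a finite sum.\<close>
      have other: "\<exists>k\<in>?D - {u, v}. \<exists>l\<in>?D - {u, v}. k \<noteq> l \<and> \<omega> (sym_diff Y {k, l}) < \<infinity>"
        if XY: "sym_diff X Y = ?D" "\<omega> (sym_diff X {u, v}) < \<infinity>" "\<omega> Y < \<infinity>" for X Y
      proof -
        have D': "sym_diff (sym_diff X {u, v}) Y = ?D - {u, v}"
          unfolding XY(1)[symmetric] using uv by (auto simp flip: XY(1))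
        have card: "card ?D = card (?D - {u, v}) + 2"
          using card_Diff_subset[of "{u, v}" ?D] card_mono[of ?D "{u, v}"] uv by auto
        then have "card (?D - {u, v}) \<noteq> 0" using D6 by linarith
        then have "?D - {u, v} \<noteq> {}" by (metis card.empty)
        then obtain k where k: "k \<in> ?D - {u, v}" by blast
        have "exchange \<omega> (sym_diff X {u, v}) Y k"
          using k card D6 by (intro IH) (auto simp: D')
        then obtain l where l: "l \<in> ?D - {u, v} - {k}" and
          le: "\<omega> (sym_diff (sym_diff X {u, v}) {k, l}) + \<omega> (sym_diff Y {k, l}) \<le>
           \<omega> (sym_diff X {u, v}) + \<omega> Y"
          unfolding exchange_def D' by blast
        have "y < \<infinity>" if "x + y \<le> x' + y'" "x \<noteq> -\<infinity>" "x' < \<infinity>" "y' < \<infinity>" for x y x' y' :: ereal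
          using that by (cases x; cases y; cases x'; cases y') auto
        from this[OF le fin XY(2,3)] show ?thesis
          using k l by (intro bexI[of _ k] bexI[of _ l]) auto
      qed
      have "\<exists>k\<in>?D - {u, v}. \<exists>l\<in>?D - {u, v}. k \<noteq> l \<and>
          (\<omega> (sym_diff A {k, l}) < \<infinity> \<or> \<omega> (sym_diff B {k, l}) < \<infinity>)"
        using uv(4) other[of A B] other[of B A] \<open>\<omega> A < \<infinity>\<close> \<open>\<omega> B < \<infinity>\<close>
        by (auto simp: Un_commute)
      then show ?thesis using step D6(1) True by blast
    qed
  qed
qed

section \<open>Finite valuations: relations through a fixed element imply the remaining ones\<close>

lemma sym_diff_assoc: "sym_diff (sym_diff A B) C = sym_diff A (sym_diff B C)"
  by blast

lemma sym_diff_interchange: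
  "sym_diff (sym_diff A B) (sym_diff C D) = sym_diff (sym_diff A C) (sym_diff B D)"
  by blast

text \<open>
  On the five elements of \<open>sym_diff A B\<close> and \<open>e\<close>, the relations whose index set contains \<open>e\<close> imply the
  others. Suppose the term of \<open>A\<close> and \<open>B\<close> is strictly minimal, normalise by a linear potential so that
  \<open>A\<close> and all \<open>A \<triangle> {i, j}\<close> have value 0, put $\beta = \omega(B)$, and let $t$ be the least value at
  \<open>A \<triangle> {e, j}\<close>, \<open>j \<noteq> i\<close>. The relations force $t \le \beta$, then the value $t + \beta$ or less at
  \<open>A \<triangle> {e, x, y, z}\<close>, while all other terms of its own relation exceed $t + \beta$.
\<close>

lemma exchange_finite_of_element:
  fixes \<omega> :: "'a set \<Rightarrow> ereal"
  assumes fin: "\<And>X. \<bar>\<omega> X\<bar> \<noteq> \<infinity>"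
    and loc: "\<And>X Y t. card (sym_diff X Y) = 4 \<Longrightarrow> e \<in> sym_diff X Y \<Longrightarrow> t \<in> sym_diff X Y \<Longrightarrow>
      exchange \<omega> X Y t"
    and card: "card (sym_diff A B) = 4" and i: "i \<in> sym_diff A B"
  shows "exchange \<omega> A B i"
proof (cases "e \<in> sym_diff A B")
  case True
  then show ?thesis using loc card i by blast
next
  case False
  define r where "r X = real_of_ereal (\<omega> X)" for X
  have r: "\<omega> X = ereal (r X)" for X
    using fin[of X] by (simp add: r_def ereal_real)
  have "card (sym_diff A B - {i}) = 3"
    using card i by simp
  then obtain x y z where xyz: "sym_diff A B - {i} = {x, y, z}" "x \<noteq> y" "y \<noteq> z" "x \<noteq> z"
    by (auto simp: card_3_iff)
  then have D: "sym_diff A B = {i, x, y, z}" and di: "i \<noteq> x" "i \<noteq> y" "i \<noteq> z"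
    using i by blast+
  with False have de: "e \<noteq> i" "e \<noteq> x" "e \<noteq> y" "e \<noteq> z" by auto
  have B: "B = sym_diff A {i, x, y, z}"
    using D by blast
  have clause: "r (sym_diff X {e, p}) + r (sym_diff X {q, s}) \<le> r X + r (sym_diff X {e, p, q, s}) \<or>
      r (sym_diff X {e, q}) + r (sym_diff X {p, s}) \<le> r X + r (sym_diff X {e, p, q, s}) \<or>
      r (sym_diff X {e, s}) + r (sym_diff X {p, q}) \<le> r X + r (sym_diff X {e, p, q, s})"
    if "p \<noteq> q" "p \<noteq> s" "q \<noteq> s" "e \<noteq> p" "e \<noteq> q" "e \<noteq> s" for X p q s
  proof -
    let ?Y = "sym_diff X {e, p, q, s}"
    have XY: "sym_diff X ?Y = {e, p, q, s}" by blast
    have "exchange \<omega> X ?Y e"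
      by (rule loc) (simp_all add: XY that)
    then obtain j where j: "j \<in> {p, q, s}"
      and le: "r (sym_diff X {e, j}) + r (sym_diff ?Y {e, j}) \<le> r X + r ?Y"
      unfolding exchange_def XY r by auto
    have "sym_diff {e, p, q, s} {e, p} = {q, s}" "sym_diff {e, p, q, s} {e, q} = {p, s}"
      "sym_diff {e, p, q, s} {e, s} = {p, q}"
      using that by auto
    then have "r (sym_diff ?Y {e, p}) = r (sym_diff X {q, s})"
      "r (sym_diff ?Y {e, q}) = r (sym_diff X {p, s})"
      "r (sym_diff ?Y {e, s}) = r (sym_diff X {p, q})"
      unfolding sym_diff_assoc by simp_all
    with j le show ?thesis by (elim insertE emptyE) (simp_all only: simp_thms)
  qed
  define G where "G U = r (sym_diff A U)" for U
  have even: "G {e, p} + G {q, s} \<le> G {} + G {e, p, q, s} \<or>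
      G {e, q} + G {p, s} \<le> G {} + G {e, p, q, s} \<or>
      G {e, s} + G {p, q} \<le> G {} + G {e, p, q, s}"
    if "p \<noteq> q" "p \<noteq> s" "q \<noteq> s" "e \<noteq> p" "e \<noteq> q" "e \<noteq> s" for p q s
    using clause[OF that, of A] by (simp only: G_def Diff_empty Un_empty_right empty_Diff)
  \<comment> \<open>The relation based at \<open>sym_diff A {e, m}\<close>: its index set is again
    \<open>{e, p, q, s}\<close>, but its sets differ from \<open>A\<close> by \<open>e\<close> and
    \<open>m\<close> in the other combination.\<close>
  have odd: "G {m, p} + G {e, m, q, s} \<le> G {e, m} + G {m, p, q, s} \<or>
      G {m, q} + G {e, m, p, s} \<le> G {e, m} + G {m, p, q, s} \<or>
      G {m, s} + G {e, m, p, q} \<le> G {e, m} + G {m, p, q, s}"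
    if "p \<noteq> q" "p \<noteq> s" "q \<noteq> s" "e \<noteq> p" "e \<noteq> q" "e \<noteq> s" "m \<noteq> e" "m \<noteq> p" "m \<noteq> q" "m \<noteq> s" for m p q s
  proof -
    let ?X = "sym_diff A {e, m}"
    have "sym_diff {e, m} {e, p} = {m, p}" "sym_diff {e, m} {e, q} = {m, q}"
      "sym_diff {e, m} {e, s} = {m, s}" "sym_diff {e, m} {q, s} = {e, m, q, s}"
      "sym_diff {e, m} {p, s} = {e, m, p, s}" "sym_diff {e, m} {p, q} = {e, m, p, q}"
      "sym_diff {e, m} {e, p, q, s} = {m, p, q, s}"
      using that by auto
    then show ?thesis
      using clause[OF that(1-6), of ?X] by (simp only: G_def sym_diff_assoc)
  qed
  have "sym_diff {i, x, y, z} {i, x} = {y, z}" "sym_diff {i, x, y, z} {i, y} = {x, z}"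
    "sym_diff {i, x, y, z} {i, z} = {x, y}"
    using xyz(2-) di by auto
  then have BG: "r (sym_diff B {i, x}) = G {y, z}" "r (sym_diff B {i, y}) = G {x, z}"
    "r (sym_diff B {i, z}) = G {x, y}"
    unfolding B sym_diff_assoc G_def by simp_all
  have AB: "r A = G {}" "r B = G {i, x, y, z}"
    by (simp_all add: G_def B)
  have goal: "exchange \<omega> A B i \<longleftrightarrow> G {i, x} + G {y, z} \<le> G {} + G {i, x, y, z} \<or>
     G {i, y} + G {x, z} \<le> G {} + G {i, x, y, z} \<or> G {i, z} + G {x, y} \<le> G {} + G {i, x, y, z}"
    unfolding exchange_def xyz r plus_ereal.simps ereal_less_eq AB
      bex_simps BG G_def[symmetric] by (simp only: simp_thms)
  \<comment> \<open>One relation based at \<open>A\<close> for each triple in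
    \<open>{i, x, y, z}\<close> and one odd relation for each choice of \<open>m\<close> there; the
    rest is linear real arithmetic.\<close>
  show ?thesis
    unfolding goal
    using even[of x y z] even[of x y i] even[of x z i] even[of y z i]
      odd[of x y z i] odd[of y z i x] odd[of x z i y] odd[of x y i z] xyz(2-) di de
    by (simp add: insert_commute) (smt (verit))
qed

section \<open>Tropical equations as exchange on the ground set extended by
  \<open>None\<close>\<close>

text \<open>Only a minimising monomial imposes a condition, since any other one is dominated by a
  minimiser. If the minimum is infinite, all monomials have equal value, and a second one exists by
  assumption.\<close>

lemma V_trop_iff:
  assumes \<nu>: "\<nu> \<in> trop_space" and M: "finite M" "\<And>u. u \<in> M \<Longrightarrow> M - {u} \<noteq> {}" "M \<noteq> {}"
    and f: "\<And>u. f u = (if u \<in> M then 0 else \<infinity>)"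
  shows "\<nu> \<in> V_trop f \<longleftrightarrow> (\<forall>u\<in>M. \<exists>w\<in>M - {u}. (\<Sum>v\<in>#w. \<nu> v) \<le> (\<Sum>v\<in>#u. \<nu> v))"
proof -
  let ?v = "\<lambda>u. \<Sum>v\<in>#u. \<nu> v"
  have val: "monom_value f \<nu> u = (if u \<in> M then ?v u else \<infinity>)" for u
    by (simp add: monom_value_def f)
  obtain u0 where u0: "u0 \<in> M" "\<And>u. u \<in> M \<Longrightarrow> ?v u0 \<le> ?v u"
    using arg_min_if_finite[of M ?v] M(1,3) by (metis not_less)
  have eval: "trop_eval f \<nu> = ?v u0"
    unfolding trop_eval_def val
  proof (rule antisym)
    show "(INF u. if u \<in> M then ?v u else \<infinity>) \<le> ?v u0"
      by (rule INF_lower2[of u0]) (use u0 in auto)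
    show "?v u0 \<le> (INF u. if u \<in> M then ?v u else \<infinity>)"
      by (rule INF_greatest) (use u0 in auto)
  qed
  have eq: "?v u = ?v u0 \<longleftrightarrow> ?v u \<le> ?v u0" if "u \<in> M" for u
    using u0(2)[OF that] by auto
  show ?thesis
  proof
    assume "\<nu> \<in> V_trop f"
    then consider "?v u0 = \<infinity>" | "?v u0 \<noteq> \<infinity>"
        "\<exists>u w. u \<noteq> w \<and> u \<in> M \<and> w \<in> M \<and> ?v u = ?v u0 \<and> ?v w = ?v u0"
      unfolding V_trop_def mem_Collect_eq eval val by (auto split: if_splits)
    then show "\<forall>u\<in>M. \<exists>w\<in>M - {u}. ?v w \<le> ?v u"
    proof cases
      case 1
      then show ?thesis using u0(2) M(2) by (metis all_not_in_conv ereal_infty_less_eq(1) ereal_less_eq(1))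
    next
      case 2
      then show ?thesis using u0(2) by (metis Diff_iff singletonD)
    qed
  next
    assume "\<forall>u\<in>M. \<exists>w\<in>M - {u}. ?v w \<le> ?v u"
    then obtain w where "w \<in> M" "u0 \<noteq> w" "?v w = ?v u0" using u0(1) eq by blast
    then show "\<nu> \<in> V_trop f"
      unfolding V_trop_def mem_Collect_eq eval val using \<nu> u0(1) by metis
  qed
qed

lemma vimage_Some_split:
  "Z = (if None \<in> Z then insert None (Some ` (Some -` Z)) else Some ` (Some -` Z))"
proof (rule set_eqI)
  show "x \<in> Z \<longleftrightarrow> x \<in> (if None \<in> Z then insert None (Some ` (Some -` Z)) else Some ` (Some -` Z))" for x
    by (cases x) auto
qed

lemma card_vimage_Some:
  fixes Z :: "'a::finite option set"
  shows "card Z = card (Some -` Z) + (if None \<in> Z then 1 else 0)"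
proof -
  have "card (Some ` (Some -` Z)) = card (Some -` Z)" by (rule card_image) simp
  with arg_cong[OF vimage_Some_split, of card Z] show ?thesis
    by (simp del: image_vimage_eq split: if_splits)
qed

lemma vimage_Some_eqD:
  assumes "Some -` X = Some -` Y"
  shows "sym_diff X Y \<subseteq> {None}"
proof -
  have "x \<in> X \<longleftrightarrow> x \<in> Y" if "x \<noteq> None" for x
    using that assms by (cases x) auto
  then show ?thesis by blast
qed

text \<open>The monomials of \<open>fB\<close> are indexed by \<open>sym_diff S T\<close>:
  \<open>Some k\<close> gives the one toggling \<open>k\<close>, while toggling \<open>None\<close>
  is invisible under \<open>Some -\<close> and gives the exceptional monomial.\<close>

lemma V_trop_fB_iff:
  fixes \<mu> :: "'n::finite set \<Rightarrow> ereal" and S T :: "'n option set"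
  assumes \<mu>: "\<mu> \<in> trop_space" and D: "even (card (sym_diff S T))" "4 \<le> card (sym_diff S T)"
  shows "\<mu> \<in> V_trop (fB (Some -` S) (Some -` T)) \<longleftrightarrow>
    (\<forall>t\<in>sym_diff S T. exchange (\<lambda>X. \<mu> (Some -` X)) (sym_diff S {t}) (sym_diff T {t}) t)"
proof -
  let ?D = "sym_diff S T" and ?I = "Some -` S" and ?J = "Some -` T"
  define m where "m t = {#Some -` sym_diff S {t}, Some -` sym_diff T {t}#}" for t
  have IJ: "sym_diff ?I ?J = Some -` ?D" by auto
  \<comment> \<open>As \<open>?D\<close> has even size, \<open>None\<close> belongs to it exactly
    when its trace on \<open>[n]\<close> has odd size, which is the case distinction in
    \<open>fB\<close>.\<close>
  have Dcases: "?D = (if even (card (sym_diff ?I ?J)) then Some ` sym_diff ?I ?J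
      else insert None (Some ` sym_diff ?I ?J))"
  proof -
    have "even (card (Some -` ?D)) \<longleftrightarrow> None \<notin> ?D"
      using D(1) unfolding card_vimage_Some[of ?D]
      by (cases "None \<in> ?D") (simp_all only: if_True if_False even_add odd_one simp_thms even_zero)
    then show ?thesis
      unfolding IJ using vimage_Some_split[of ?D] by metis
  qed
  have mSome: "m (Some k) = {#sym_diff ?I {k}, sym_diff ?J {k}#}" for k
    unfolding m_def by (auto intro!: arg_cong2[where f = "\<lambda>a b. {#a, b#}"])
  have mNone: "m None = {#?I, ?J#}"
    unfolding m_def by (auto intro!: arg_cong2[where f = "\<lambda>a b. {#a, b#}"])
  have inf: "(INF k\<in>K. trop_monom (g k)) u = (if u \<in> g ` K then 0 else \<infinity>)"
    for K u and g :: "'n \<Rightarrow> 'n set multiset"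
  proof -
    have "(INF k\<in>K. trop_monom (g k)) u = (INF k\<in>K. if u = g k then 0 else \<infinity>)"
      by (simp only: INF_apply trop_monom_def)
    also have "\<dots> = (if u \<in> g ` K then 0 else \<infinity>)"
    proof (cases "u \<in> g ` K")
      case True
      then obtain k where "k \<in> K" "u = g k" by blast
      then show ?thesis
        by (intro antisym INF_lower2[of k] INF_greatest) auto
    next
      case False
      then have "(INF k\<in>K. if u = g k then 0 else \<infinity>) = (INF k\<in>K. \<infinity>::ereal)"
        by (intro INF_cong) auto
      also have "\<dots> = \<infinity>" by (metis INF_top_conv(2) top_ereal_def)
      finally show ?thesis using False by simp
    qed
    finally show ?thesis .
  qed
  have fB: "fB ?I ?J u = (if u \<in> m ` ?D then 0 else \<infinity>)" for u
  proof (cases "even (card (sym_diff ?I ?J))")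
    case True
    then have "?D = Some ` sym_diff ?I ?J" using Dcases by metis
    then show ?thesis
      using True by (simp only: fB_def Let_def if_True inf mSome[symmetric] image_image)
  next
    case False
    then have "?D = insert None (Some ` sym_diff ?I ?J)" using Dcases by metis
    then show ?thesis
      using False
      by (simp only: fB_def Let_def if_False inf mSome[symmetric] mNone[symmetric] image_insert image_image
          inf_apply trop_monom_def[of "m None"])
        (simp add: inf_ereal_def)
  qed
  \<comment> \<open>Distinct indices must give distinct monomials, or attaining the minimum twice
    would lose its meaning. Traces agree only for sets differing at most in \<open>None\<close>;
    here the sets differ in \<open>{s, t}\<close> or in \<open>?D - {s, t}\<close>, which has at
    least two elements because \<open>?D\<close> has at least four.\<close>
  have inj: "inj_on m ?D"
  proof (rule inj_onI, rule ccontr)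
    fix s t assume st: "s \<in> ?D" "t \<in> ?D" "m s = m t" "s \<noteq> t"
    have ne: "Some -` X \<noteq> Some -` Y" if "2 \<le> card (sym_diff X Y)" for X Y :: "'n option set"
    proof
      assume "Some -` X = Some -` Y"
      then have "card (sym_diff X Y) \<le> card {None :: 'n option}"
        by (intro card_mono vimage_Some_eqD) simp_all
      then show False using that by simp
    qed
    have "sym_diff (sym_diff S {s}) (sym_diff S {t}) = {s, t}"
      using st(4) unfolding sym_diff_interchange[of S] by (simp add: insert_commute)
    then have "card (sym_diff (sym_diff S {s}) (sym_diff S {t})) = 2"
      using st(4) by (simp only: card_2_iff) blast
    then have "Some -` sym_diff S {s} \<noteq> Some -` sym_diff S {t}"
      by (intro ne) (simp only: order_refl)
    moreover have eq: "sym_diff (sym_diff S {s}) (sym_diff T {t}) = ?D - {s, t}"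
    proof -
      have "sym_diff {s} {t} = {s, t}" using st(4) by (simp add: insert_commute)
      moreover have "sym_diff ?D {s, t} = ?D - {s, t}" using st(1,2) by blast
      ultimately show ?thesis unfolding sym_diff_interchange[of S] by simp
    qed
    have "card ?D - card {s, t} \<le> card (?D - {s, t})"
      by (rule diff_card_le_card_Diff) simp
    then have "2 \<le> card (?D - {s, t})" using D(2) st(4) by simp
    then have "Some -` sym_diff S {s} \<noteq> Some -` sym_diff T {t}"
      by (intro ne) (simp only: eq)
    moreover have pair_eq: "a = c \<or> a = d" if "{#a, b#} = {#c, d#}" for a b c d :: "'n set"
      using that by (auto simp: add_eq_conv_diff split: if_splits)
    ultimately show False
      using st(3) pair_eq unfolding m_def by blast
  qed
  have ne: "?D - {t} \<noteq> {}" for t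
  proof
    assume "?D - {t} = {}"
    then have "card ?D \<le> card {t}" by (intro card_mono) blast+
    then show False using D(2) by simp
  qed
  have "\<mu> \<in> V_trop (fB ?I ?J) \<longleftrightarrow> (\<forall>u\<in>m ` ?D. \<exists>w\<in>m ` ?D - {u}. (\<Sum>v\<in>#w. \<mu> v) \<le> (\<Sum>v\<in>#u. \<mu> v))"
  proof (rule V_trop_iff[OF \<mu> _ _ _ fB])
    show "m ` ?D - {u} \<noteq> {}" if "u \<in> m ` ?D" for u
    proof -
      from that obtain t where t: "t \<in> ?D" "u = m t" by blast
      obtain s where "s \<in> ?D" "s \<noteq> t" using ne[of t] by blast
      then have "m s \<in> m ` ?D - {u}" using inj t by (simp add: inj_on_eq_iff)
      then show ?thesis by blast
    qed
    show "m ` ?D \<noteq> {}" using ne by blast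
  qed simp
  also have "\<dots> \<longleftrightarrow> (\<forall>t\<in>?D. \<exists>s\<in>?D - {t}. (\<Sum>v\<in>#m s. \<mu> v) \<le> (\<Sum>v\<in>#m t. \<mu> v))"
  proof -
    have "m ` ?D - {m t} = m ` (?D - {t})" if "t \<in> ?D" for t
      using inj_on_image_set_diff[OF inj, of ?D "{t}"] that by simp
    then show ?thesis by (simp only: ball_simps(9) bex_simps(7) cong: ball_cong)
  qed
  also have "\<dots> \<longleftrightarrow> (\<forall>t\<in>?D. exchange (\<lambda>X. \<mu> (Some -` X)) (sym_diff S {t}) (sym_diff T {t}) t)"
  proof (rule ball_cong[OF refl])
    fix t assume "t \<in> ?D"
    have msum: "(\<Sum>v\<in>#m s. \<mu> v) = \<mu> (Some -` sym_diff S {s}) + \<mu> (Some -` sym_diff T {s})" for s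
      by (simp add: m_def)
    have "sym_diff (sym_diff S {t}) (sym_diff T {t}) = ?D"
      unfolding sym_diff_interchange[of S] by simp
    moreover have "sym_diff (sym_diff X {t}) {t, s} = sym_diff X {s}" if "s \<in> ?D - {t}" for s X
    proof -
      have "sym_diff {t} {t, s} = {s}" using that by auto
      then show ?thesis unfolding sym_diff_assoc by simp
    qed
    ultimately show "(\<exists>s\<in>?D - {t}. (\<Sum>v\<in>#m s. \<mu> v) \<le> (\<Sum>v\<in>#m t. \<mu> v)) \<longleftrightarrow>
       exchange (\<lambda>X. \<mu> (Some -` X)) (sym_diff S {t}) (sym_diff T {t}) t"
      by (simp only: exchange_def msum cong: bex_cong)
  qed
  finally show ?thesis .
qed

section \<open>Reflections of the cube and the strong Coxeter property\<close>

lemma cube_vertex_nth: "cube_vertex A $ k = (if k \<in> A then 1 / 2 else - 1 / 2)"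
proof -
  have "(\<Sum>i\<in>A. axis i (1::real) $ k) = (\<Sum>i\<in>A. if i = k then 1 else 0)"
    by (intro sum.cong) (auto simp: axis_def)
  then show ?thesis by (simp add: cube_vertex_def sum.delta)
qed

lemma inj_cube_vertex: "inj cube_vertex"
proof (rule injI, rule set_eqI)
  fix A B :: "'a set" and k
  assume "cube_vertex A = cube_vertex B"
  then have "cube_vertex A $ k = cube_vertex B $ k" by simp
  then show "k \<in> A \<longleftrightarrow> k \<in> B" by (auto simp: cube_vertex_nth split: if_splits)
qed

text \<open>Short roots toggle one coordinate. A long root whose mirror avoids a vertex toggles both
  of its coordinates there, and separation forces these coordinates to differ between
  \<open>A\<close> and \<open>B\<close>.\<close>

lemma strong_coxeter_exchange:
  assumes M: "strong_coxeter_matroid_B M" and AB: "A \<in> M" "B \<in> M" "A \<noteq> B"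
  obtains (single) i where "i \<in> sym_diff A B" "sym_diff A {i} \<in> M" "sym_diff B {i} \<in> M"
  | (double) i j where "i \<in> sym_diff A B" "j \<in> sym_diff A B" "i \<noteq> j"
      "sym_diff A {i, j} \<in> M" "sym_diff B {i, j} \<in> M"
proof -
  obtain \<alpha> where \<alpha>: "\<alpha> \<in> B_roots" and sep: "mirror_separates \<alpha> (cube_vertex A) (cube_vertex B)"
    and refl: "root_reflection \<alpha> (cube_vertex A) \<in> cube_vertex ` M"
      "root_reflection \<alpha> (cube_vertex B) \<in> cube_vertex ` M"
    using M AB unfolding strong_coxeter_matroid_B_def by blast
  have mem: "X \<in> M" if "cube_vertex X \<in> cube_vertex ` M" for X
    using that inj_cube_vertex by (auto dest: injD)
  from \<alpha> consider c i where "\<alpha> = c *\<^sub>R axis i 1" "c = 1 \<or> c = -1"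
    | c d i j where "\<alpha> = c *\<^sub>R axis i 1 + d *\<^sub>R axis j 1" "c = 1 \<or> c = -1" "d = 1 \<or> d = -1" "i \<noteq> j"
    unfolding B_roots_def by blast
  then show thesis
  proof cases
    case 1
    have inner: "\<alpha> \<bullet> x = c * x $ i" for x
      by (simp add: 1 inner_axis')
    have "root_reflection \<alpha> (cube_vertex X) = cube_vertex (sym_diff X {i})" for X
      using 1(2) unfolding root_reflection_def inner
      by (auto simp: vec_eq_iff cube_vertex_nth 1(1) axis_def)
    moreover have "i \<in> sym_diff A B"
      using sep 1(2) by (auto simp: mirror_separates_def inner cube_vertex_nth split: if_splits)
    ultimately show thesis using refl mem single by metis
  next
    case 2
    have inner: "\<alpha> \<bullet> x = c * x $ i + d * x $ j" for x
      by (simp add: 2 inner_axis' inner_add_left)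
    have "root_reflection \<alpha> (cube_vertex X) = cube_vertex (sym_diff X {i, j})"
      if "\<alpha> \<bullet> cube_vertex X \<noteq> 0" for X
    proof -
      \<comment> \<open>Both summands of the inner product are 1/2 or -1/2, so a nonzero sum makes
        them equal, and the reflection then negates both coordinates.\<close>
      have eq: "d * cube_vertex X $ j = c * cube_vertex X $ i"
        using that 2(2,3) unfolding inner by (auto simp: cube_vertex_nth split: if_splits)
      have "\<alpha> \<bullet> \<alpha> = 2"
        using 2(2-) unfolding inner by (auto simp: 2(1) axis_def)
      then have refl: "root_reflection \<alpha> x = x - (c * x $ i + d * x $ j) *\<^sub>R \<alpha>" for x
        by (simp add: root_reflection_def inner)
      have "\<alpha> $ k = (if k = i then c else if k = j then d else 0)" for k
        using 2(4) by (simp add: 2(1) axis_def)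
      then have "root_reflection \<alpha> (cube_vertex X) $ k =
          (if k = i \<or> k = j then - cube_vertex X $ k else cube_vertex X $ k)" for k
        unfolding refl using 2(2,3) eq by (elim disjE) auto
      then show ?thesis by (simp add: vec_eq_iff cube_vertex_nth)
    qed
    moreover have "\<alpha> \<bullet> cube_vertex A \<noteq> 0" "\<alpha> \<bullet> cube_vertex B \<noteq> 0"
      using sep by (auto simp: mirror_separates_def)
    moreover have "i \<in> sym_diff A B" "j \<in> sym_diff A B"
      using sep 2(2,3) by (auto simp: mirror_separates_def inner cube_vertex_nth split: if_splits)
    ultimately show thesis using refl mem double 2(4) by metis
  qed
qed

text \<open>Provides the hypothesis \<open>supp\<close> of \<open>exchange_local_to_global\<close>
  for the lifted valuation. A double exchange lifts directly; a single one needs a partner.\<close>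

lemma strong_coxeter_lift_pair:
  fixes X Y :: "'n::finite option set"
  assumes M: "strong_coxeter_matroid_B M" and XY: "Some -` X \<in> M" "Some -` Y \<in> M"
    and D: "even (card (sym_diff X Y))" "4 \<le> card (sym_diff X Y)"
  shows "\<exists>u\<in>sym_diff X Y. \<exists>v\<in>sym_diff X Y. u \<noteq> v \<and>
    (Some -` sym_diff X {u, v} \<in> M \<or> Some -` sym_diff Y {u, v} \<in> M)"
proof -
  let ?A = "Some -` X" and ?B = "Some -` Y"
  have small: "sym_diff X Y \<subseteq> {a, b} \<Longrightarrow> False" for a b
    using D card_mono[of "{a, b}" "sym_diff X Y"] card_insert_le_m1[of 2 "{b}" a] by auto
  have "?A \<noteq> ?B"
  proof
    assume "?A = ?B"
    then have "sym_diff X Y \<subseteq> {None, None}" using vimage_Some_eqD by blast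
    then show False by (rule small)
  qed
  have pair: ?thesis
    if "i \<in> sym_diff ?A ?B" "j \<in> sym_diff ?A ?B" "i \<noteq> j"
      "sym_diff ?A {i, j} \<in> M \<or> sym_diff ?B {i, j} \<in> M" for i j
  proof -
    have "Some -` sym_diff Z {Some i, Some j} = sym_diff (Some -` Z) {i, j}" for Z :: "'n option set"
      by auto
    then have "Some -` sym_diff X {Some i, Some j} \<in> M \<or> Some -` sym_diff Y {Some i, Some j} \<in> M"
      using that(4) by simp
    moreover have "Some i \<in> sym_diff X Y" "Some j \<in> sym_diff X Y" "Some i \<noteq> Some j"
      using that(1-3) by blast+
    ultimately show ?thesis by blast
  qed
  from M XY \<open>?A \<noteq> ?B\<close> show ?thesis
  proof (cases rule: strong_coxeter_exchange)
    case (double i j)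
    then show ?thesis using pair by blast
  next
    case (single i)
    \<comment> \<open>Toggling \<open>i\<close> alone amounts to toggling \<open>Some i\<close> and \<open>None\<close>. If \<open>None\<close> is not available, exchanging
      between \<open>sym_diff ?A {i}\<close> and \<open>?B\<close> toggles either \<open>i\<close> and a second element, or a pair in \<open>?B\<close>.\<close>
    show ?thesis
    proof (cases "None \<in> sym_diff X Y")
      case True
      have "Some -` sym_diff X {Some i, None} = sym_diff ?A {i}" by auto
      then have "Some -` sym_diff X {Some i, None} \<in> M" using single(2) by simp
      moreover have "Some i \<in> sym_diff X Y" using single(1) by blast
      ultimately show ?thesis using True by blast
    next
      case False
      have D': "sym_diff (sym_diff ?A {i}) ?B = sym_diff ?A ?B - {i}"
        using single by auto
      have "sym_diff ?A {i} \<noteq> ?B"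
      proof
        assume "sym_diff ?A {i} = ?B"
        then have "k \<in> ?A \<longleftrightarrow> k \<in> ?B" if "k \<noteq> i" for k
          using that by blast
        then have "x \<in> X \<longleftrightarrow> x \<in> Y" if "x \<noteq> None" "x \<noteq> Some i" for x
          using that by (cases x) auto
        then have "sym_diff X Y \<subseteq> {None, Some i}" by blast
        then show False by (rule small)
      qed
      with M single(2) XY(2) show ?thesis
      proof (cases rule: strong_coxeter_exchange)
        case (single k)
        have "sym_diff (sym_diff ?A {i}) {k} = sym_diff ?A {i, k}"
          using single(1) unfolding D' by auto
        then have "sym_diff ?A {i, k} \<in> M" using single(2) by simp
        moreover have "k \<in> sym_diff ?A ?B" "i \<noteq> k" using single(1) unfolding D' by blast+
        ultimately show ?thesis using pair \<open>i \<in> sym_diff ?A ?B\<close> by blast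
      next
        case (double j k)
        then have "j \<in> sym_diff ?A ?B" "k \<in> sym_diff ?A ?B" unfolding D' by blast+
        then show ?thesis using pair double(3,5) by blast
      qed
    qed
  qed
qed

section \<open>Transfer between the equations and exchange, and the conclusion\<close>

text \<open>Toggling \<open>i\<close> in both sets turns the given pair into the index pair of an
  equation. The size in \<open>V\<close> is exact, so that for lifted size 4 only size 3 is asked
  for when \<open>None\<close> is involved, and only size 4 otherwise.\<close>

lemma exchange_if_V_trop_fB:
  fixes \<mu> :: "'n::finite set \<Rightarrow> ereal" and A B :: "'n option set"
  assumes \<mu>: "\<mu> \<in> trop_space" and D: "even (card (sym_diff A B))" "4 \<le> card (sym_diff A B)"
    and i: "i \<in> sym_diff A B"
    and V: "\<And>I J. card (sym_diff A B) = card (sym_diff I J) + (if None \<in> sym_diff A B then 1 else 0) \<Longrightarrow>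
      \<mu> \<in> V_trop (fB I J)"
  shows "exchange (\<lambda>X. \<mu> (Some -` X)) A B i"
proof -
  let ?S = "sym_diff A {i}" and ?T = "sym_diff B {i}"
  have ST: "sym_diff ?S ?T = sym_diff A B"
    unfolding sym_diff_interchange[of A] by simp
  have SS: "sym_diff (sym_diff X {i}) {i} = X" for X by blast
  have "sym_diff (Some -` ?S) (Some -` ?T) = Some -` sym_diff ?S ?T" by blast
  then have "sym_diff (Some -` ?S) (Some -` ?T) = Some -` sym_diff A B" unfolding ST .
  then have "\<mu> \<in> V_trop (fB (Some -` ?S) (Some -` ?T))"
    by (intro V) (simp only: card_vimage_Some[of "sym_diff A B"])
  moreover have "even (card (sym_diff ?S ?T))" "4 \<le> card (sym_diff ?S ?T)"
    unfolding ST by (rule D)+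
  ultimately have "\<forall>t\<in>sym_diff ?S ?T.
      exchange (\<lambda>X. \<mu> (Some -` X)) (sym_diff ?S {t}) (sym_diff ?T {t}) t"
    using V_trop_fB_iff[OF \<mu>, of ?S ?T] by blast
  then have "exchange (\<lambda>X. \<mu> (Some -` X)) (sym_diff ?S {i}) (sym_diff ?T {i}) i"
    using i unfolding ST by blast
  then show ?thesis unfolding SS .
qed

lemma V_trop_fB_if_exchange:
  fixes \<mu> :: "'n::finite set \<Rightarrow> ereal"
  assumes \<mu>: "\<mu> \<in> trop_space" and IJ: "3 \<le> card (sym_diff I J)"
    and ex: "\<And>(A :: 'n option set) B i. even (card (sym_diff A B)) \<Longrightarrow> 4 \<le> card (sym_diff A B) \<Longrightarrow>
      i \<in> sym_diff A B \<Longrightarrow> exchange (\<lambda>X. \<mu> (Some -` X)) A B i"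
  shows "\<mu> \<in> V_trop (fB I J)"
proof -
  \<comment> \<open>\<open>None\<close> is added on one side exactly in the odd case, making the
    lifted size even; in particular 3 becomes 4.\<close>
  let ?T = "(if even (card (sym_diff I J)) then {} else {None}) \<union> Some ` J"
  obtain S T :: "'n option set" where v: "Some -` S = I" "Some -` T = J"
    and None: "None \<in> sym_diff S T \<longleftrightarrow> odd (card (sym_diff I J))"
  proof
    show "Some -` Some ` I = I" "Some -` ?T = J" by auto
    show "None \<in> sym_diff (Some ` I) ?T \<longleftrightarrow> odd (card (sym_diff I J))"
      by (cases "even (card (sym_diff I J))") (simp_all only: if_True if_False, blast+)
  qed
  have IJ_eq: "sym_diff I J = Some -` sym_diff S T"
    unfolding v[symmetric] by blast
  have "card (sym_diff S T) =
      card (sym_diff I J) + (if odd (card (sym_diff I J)) then 1 else 0)"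
    using card_vimage_Some[of "sym_diff S T"] None unfolding IJ_eq[symmetric] by (simp only:)
  moreover have "even (n + (if odd n then 1 else 0))" "3 \<le> n \<Longrightarrow> 4 \<le> n + (if odd n then 1 else 0)"
    for n :: nat by presburger+
  ultimately have D: "even (card (sym_diff S T))" "4 \<le> card (sym_diff S T)"
    using IJ by presburger+
  have ST: "sym_diff (sym_diff S {t}) (sym_diff T {t}) = sym_diff S T" for t
    unfolding sym_diff_interchange[of S] by simp
  have "exchange (\<lambda>X. \<mu> (Some -` X)) (sym_diff S {t}) (sym_diff T {t}) t" if "t \<in> sym_diff S T" for t
    by (rule ex; unfold ST) (rule D that)+
  then have "\<mu> \<in> V_trop (fB (Some -` S) (Some -` T))"
    using V_trop_fB_iff[OF \<mu> D] by blast
  then show ?thesis unfolding v .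
qed

theorem theorem4p9:
  fixes \<mu> :: "'n::finite set \<Rightarrow> ereal"
  assumes "\<mu> \<in> trop_space"
    and "strong_coxeter_matroid_B (trop_supp \<mu>)"
  shows "(\<mu> \<in> DrB \<longleftrightarrow>
        (\<forall>I J. 3 \<le> card (sym_diff I J) \<and> card (sym_diff I J) \<le> 4 \<longrightarrow> \<mu> \<in> V_trop (fB I J))) \<and>
      ((\<forall>A. \<mu> A < \<infinity>) \<longrightarrow>
        (\<mu> \<in> DrB \<longleftrightarrow> (\<forall>I J. card (sym_diff I J) = 3 \<longrightarrow> \<mu> \<in> V_trop (fB I J))))"
proof -
  let ?\<omega> = "\<lambda>X. \<mu> (Some -` X)"
  let ?local = "\<forall>A B i. card (sym_diff A B) = 4 \<longrightarrow> i \<in> sym_diff A B \<longrightarrow> exchange ?\<omega> A B i"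
  have fin: "\<mu> A \<noteq> -\<infinity>" for A
    using assms(1) by (simp add: trop_space_def trop_def)
  have global: "\<mu> \<in> DrB" if ?local
  proof -
    have "exchange ?\<omega> A B i"
      if "even (card (sym_diff A B))" "4 \<le> card (sym_diff A B)" "i \<in> sym_diff A B" for A B i
    proof (rule exchange_local_to_global[OF fin _ _ that])
      show "\<exists>u\<in>sym_diff X Y. \<exists>v\<in>sym_diff X Y. u \<noteq> v \<and>
          (?\<omega> (sym_diff X {u, v}) < \<infinity> \<or> ?\<omega> (sym_diff Y {u, v}) < \<infinity>)"
        if "even (card (sym_diff X Y))" "6 \<le> card (sym_diff X Y)" "?\<omega> X < \<infinity>" "?\<omega> Y < \<infinity>"
        for X Y :: "'n option set"
        using strong_coxeter_lift_pair[OF assms(2), of X Y] that by (simp add: trop_supp_def)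
    qed (use \<open>?local\<close> in blast)
    then have "\<mu> \<in> V_trop (fB I J)" if "3 \<le> card (sym_diff I J)" for I J
      using V_trop_fB_if_exchange[OF assms(1) that] by blast
    then show ?thesis using assms(1) by (simp add: DrB_def)
  qed
  have DrB_V: "\<mu> \<in> V_trop (fB I J)" if "\<mu> \<in> DrB" "3 \<le> card (sym_diff I J)" for I J
    using that by (auto simp: DrB_def)
  have "\<mu> \<in> DrB"
    if V: "\<And>I J. 3 \<le> card (sym_diff I J) \<and> card (sym_diff I J) \<le> 4 \<Longrightarrow> \<mu> \<in> V_trop (fB I J)"
  proof (intro global allI impI)
    fix A B :: "'n option set" and i
    assume "card (sym_diff A B) = 4" "i \<in> sym_diff A B"
    then show "exchange ?\<omega> A B i"
      by (intro exchange_if_V_trop_fB assms(1) V) (simp_all split: if_splits)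
  qed
  \<comment> \<open>For finite values, \<open>exchange_finite_of_element\<close> with
    \<open>None\<close> as the fixed element leaves only lifted pairs through \<open>None\<close>,
    which come from size 3.\<close>
  moreover have "\<mu> \<in> DrB"
    if finite: "\<forall>A. \<mu> A < \<infinity>" and V: "\<And>I J. card (sym_diff I J) = 3 \<Longrightarrow> \<mu> \<in> V_trop (fB I J)"
  proof (intro global allI impI)
    fix A B :: "'n option set" and i
    assume AB: "card (sym_diff A B) = 4" "i \<in> sym_diff A B"
    show "exchange ?\<omega> A B i"
    proof (rule exchange_finite_of_element[of ?\<omega> None, OF _ _ AB])
      show "\<bar>?\<omega> X\<bar> \<noteq> \<infinity>" for X
        using fin[of "Some -` X"] finite by (auto simp: less_top[symmetric])
      show "exchange ?\<omega> X Y t"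
        if "card (sym_diff X Y) = 4" "None \<in> sym_diff X Y" "t \<in> sym_diff X Y" for X Y t
      proof (rule exchange_if_V_trop_fB[OF assms(1) _ _ that(3)])
        show "\<mu> \<in> V_trop (fB I J)"
          if "card (sym_diff X Y) = card (sym_diff I J) + (if None \<in> sym_diff X Y then 1 else 0)" for I J
          using that \<open>card (sym_diff X Y) = 4\<close> \<open>None \<in> sym_diff X Y\<close> by (intro V) (simp only: if_True)
      qed (simp_all only: that, simp_all)
    qed
  qed
  ultimately show ?thesis
    using DrB_V by (metis order_refl)
qed

end
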